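(* Let $(\mathcal{H},S_b,s)$ be a complete symmetric $S_b$-metric space, $s\ge1$. Define the strictly decreasing function $\eta:[0,\tfrac1s)\to(\tfrac{1}{2s+1},\tfrac{1}{2s}]$ by $$\eta(r)=\frac{1}{s(2+r)},$$ and let $T:\mathcal{H}\to\mathcal{CB}(\mathcal{H})$ be a mapping. Assume that there exists $r\in[0,\tfrac1s)$ such that, for all $h,t\in\mathcal{H}$, $$\eta(r)\,D_b(h,Th)\le S_b(h,h,t)\quad\text{implies}\quad H_b(Th,Th,Tt)\le r\,S_b(h,h,t).$$ Then there exists $z\in\mathcal{H}$ such that $z\in Tz$.
   Context: An $S_b$-metric space is a triple $(X,S_b,s)$ where $X$ is a non-empty set, $s\ge 1$ is a real number, and $S_b:X^3\to[0,\infty)$ satisfies, for all $u,w,v,t\in X$: (i) $S_b(u,w,v)=0$ if and only if $u=w=v$; (ii) $S_b(u,w,v)\le s[S_b(u,u,t)+S_b(w,w,t)+S_b(v,v,t)]$. It is symmetric if $S_b(u,u,w)=S_b(w,w,u)$ for all $u,w\in X$. A sequence $(h_n)$ in $\mathcal{H}$ converges to $h\in\mathcal{H}$ if $S_b(h_n,h_n,h)\to 0$ as $n\to\infty$; it is Cauchy if $S_b(h_n,h_n,h_m)\to 0$ as $n,m\to\infty$; $(\mathcal{H},S_b,s)$ is complete if every Cauchy sequence converges to a point of $\mathcal{H}$. A subset $K\subseteq\mathcal{H}$ is closed if it contains every point $x\in\mathcal{H}$ that is the limit of some sequence of points of $K$. A subset $K$ is bounded if $\sup\{S_b(h,u,v):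 h,u,v\in K\}<\infty$. $\mathcal{CB}(\mathcal{H})$ denotes the set of all non-empty closed and bounded subsets of $\mathcal{H}$. For $h\in\mathcal{H}$ and $R\in\mathcal{CB}(\mathcal{H})$, $D_b(h,R)=\inf\{S_b(h,h,r): r\in R\}$. For $P,Q,R\in\mathcal{CB}(\mathcal{H})$, $$H_b(P,Q,R)=\max\Big\{\max\big\{\sup_{p\in P}D_b(p,R),\ \sup_{p\in P}D_b(p,Q)\big\},\ \max\big\{\sup_{r\in R}D_b(r,P),\ \sup_{r\in R}D_b(r,Q)\big\},\ \max\big\{\sup_{q\in Q}D_b(q,P),\ \sup_{q\in Q}D_b(q,R)\big\}\Big\}.$$ *)

theory Defs
  imports "HOL-Analysis.Analysis"
begin

text \<open>An $S_b$-metric space on an explicit carrier set. The function \<open>S\<close> is total on the type,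
  but only its values on the carrier are constrained and used.\<close>

locale Sb_metric_space =
  fixes X :: "'a set" and S :: "'a \<Rightarrow> 'a \<Rightarrow> 'a \<Rightarrow> real" and s :: real
  assumes nonempty: "X \<noteq> {}"
    and s_ge_1: "s \<ge> 1"
    and nonneg: "\<lbrakk>u \<in> X; w \<in> X; v \<in> X\<rbrakk> \<Longrightarrow> S u w v \<ge> 0"
    and eq_0_iff: "\<lbrakk>u \<in> X; w \<in> X; v \<in> X\<rbrakk> \<Longrightarrow> S u w v = 0 \<longleftrightarrow> u = w \<and> w = v"
    and triangle: "\<lbrakk>u \<in> X; w \<in> X; v \<in> X; t \<in> X\<rbrakk> \<Longrightarrow>
      S u w v \<le> s * (S u u t + S w w t + S v v t)"

locale symmetric_Sb_metric_space = Sb_metric_space +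
  assumes symmetric: "\<lbrakk>u \<in> X; w \<in> X\<rbrakk> \<Longrightarrow> S u u w = S w w u"

definition Sb_converges :: "('a \<Rightarrow> 'a \<Rightarrow> 'a \<Rightarrow> real) \<Rightarrow> (nat \<Rightarrow> 'a) \<Rightarrow> 'a \<Rightarrow> bool" where
  "Sb_converges S h x \<longleftrightarrow> (\<lambda>n. S (h n) (h n) x) \<longlonglongrightarrow> 0"

definition Sb_Cauchy :: "('a \<Rightarrow> 'a \<Rightarrow> 'a \<Rightarrow> real) \<Rightarrow> (nat \<Rightarrow> 'a) \<Rightarrow> bool" where
  "Sb_Cauchy S h \<longleftrightarrow> (\<forall>\<epsilon>>0. \<exists>N. \<forall>n\<ge>N. \<forall>m\<ge>N. \<bar>S (h n) (h n) (h m)\<bar> < \<epsilon>)"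

definition Sb_complete :: "'a set \<Rightarrow> ('a \<Rightarrow> 'a \<Rightarrow> 'a \<Rightarrow> real) \<Rightarrow> bool" where
  "Sb_complete X S \<longleftrightarrow>
    (\<forall>h. (\<forall>n. h n \<in> X) \<and> Sb_Cauchy S h \<longrightarrow> (\<exists>x\<in>X. Sb_converges S h x))"

definition Sb_closed :: "'a set \<Rightarrow> ('a \<Rightarrow> 'a \<Rightarrow> 'a \<Rightarrow> real) \<Rightarrow> 'a set \<Rightarrow> bool" where
  "Sb_closed X S K \<longleftrightarrow>
    (\<forall>x\<in>X. (\<exists>h. (\<forall>n. h n \<in> K) \<and> Sb_converges S h x) \<longrightarrow> x \<in> K)"

definition Sb_bounded :: "('a \<Rightarrow> 'a \<Rightarrow> 'a \<Rightarrow> real) \<Rightarrow> 'a set \<Rightarrow> bool" where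
  "Sb_bounded S K \<longleftrightarrow> bdd_above {S h u v | h u v. h \<in> K \<and> u \<in> K \<and> v \<in> K}"

definition CB :: "'a set \<Rightarrow> ('a \<Rightarrow> 'a \<Rightarrow> 'a \<Rightarrow> real) \<Rightarrow> 'a set set" where
  "CB X S = {K. K \<subseteq> X \<and> K \<noteq> {} \<and> Sb_closed X S K \<and> Sb_bounded S K}"

text \<open>The infima and suprema below are taken in the reals. For arguments in \<open>CB X S\<close> (and points
  of \<open>X\<close>) they range over non-empty sets that are bounded on the relevant side, so they agree with
  the extended-real ones.\<close>

definition D\<^sub>b :: "('a \<Rightarrow> 'a \<Rightarrow> 'a \<Rightarrow> real) \<Rightarrow> 'a \<Rightarrow> 'a set \<Rightarrow> real" where
  "D\<^sub>b S h R = (INF r\<in>R. S h h r)"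

definition H\<^sub>b :: "('a \<Rightarrow> 'a \<Rightarrow> 'a \<Rightarrow> real) \<Rightarrow> 'a set \<Rightarrow> 'a set \<Rightarrow> 'a set \<Rightarrow> real" where
  "H\<^sub>b S P Q R =
    max (max (SUP p\<in>P. D\<^sub>b S p R) (SUP p\<in>P. D\<^sub>b S p Q))
      (max (max (SUP r\<in>R. D\<^sub>b S r P) (SUP r\<in>R. D\<^sub>b S r Q))
           (max (SUP q\<in>Q. D\<^sub>b S q P) (SUP q\<in>Q. D\<^sub>b S q R)))"

definition \<eta> :: "real \<Rightarrow> real \<Rightarrow> real" where
  "\<eta> s r = 1 / (s * (2 + r))"

lemma \<eta>_range:
  assumes "s \<ge> 1" "r \<in> {0..<1/s}"
  shows "\<eta> s r \<in> {1/(2 * s + 1)<..1/(2 * s)}"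
proof -
  have "s * r < 1" "0 \<le> s * r"
    using assms by (auto simp: field_simps)
  then have "0 < s * (2 + r)" "s * (2 + r) < 2 * s + 1" "2 * s \<le> s * (2 + r)"
    using assms(1) by (simp_all add: distrib_left)
  then show ?thesis
    using assms unfolding \<eta>_def by (auto intro!: divide_strict_left_mono divide_left_mono)
qed

lemma \<eta>_strict_antimono:
  assumes "s \<ge> 1"
  shows "strict_antimono_on {0..<1/s} (\<eta> s)"
  using assms unfolding \<eta>_def
  by (intro monotone_onI divide_strict_left_mono mult_strict_left_mono) auto

end

theory Submission
  imports Defs
begin

text \<open>Iterating \<open>T\<close> gives an orbit \<open>u (Suc n) \<in> T (u n)\<close> whose consecutive distances decay
  geometrically with a ratio below \<open>1/s\<close>, so it converges to some \<open>z\<close>. The constant \<open>\<eta> s r\<close> is such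
  that, of any two consecutive indices, at least one \<open>m\<close> satisfies
  \<open>\<eta> s r * D\<^sub>b S (u m) (T (u m)) \<le> S (u m) (u m) z\<close>: if both failed, the triangle inequality through
  \<open>z\<close> would give \<open>S (u n) (u n) (u (Suc n)) < S (u n) (u n) (u (Suc n))\<close>. Hence the contraction
  applies to \<open>u m\<close> and \<open>z\<close> for infinitely many \<open>m\<close>, which forces \<open>D\<^sub>b S z (T z) = 0\<close>.\<close>

section \<open>Point-to-set distances and their bound by \<open>H\<^sub>b\<close>\<close>

context Sb_metric_space
begin

lemma self_eq_0: "u \<in> X \<Longrightarrow> S u u u = 0"
  by (simp add: eq_0_iff)

lemma pos: "\<lbrakk>u \<in> X; v \<in> X; u \<noteq> v\<rbrakk> \<Longrightarrow> S u u v > 0"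
  using nonneg[of u u v] eq_0_iff[of u u v] by auto

lemma triangle2: "\<lbrakk>u \<in> X; v \<in> X; t \<in> X\<rbrakk> \<Longrightarrow> S u u v \<le> s * (2 * S u u t + S v v t)"
  using triangle[of u u v t] by simp

lemma CB_D: "K \<in> CB X S \<Longrightarrow> K \<subseteq> X" "K \<in> CB X S \<Longrightarrow> K \<noteq> {}"
  by (auto simp: CB_def)

lemma bdd_below_dist: "\<lbrakk>h \<in> X; R \<subseteq> X\<rbrakk> \<Longrightarrow> bdd_below ((\<lambda>r. S h h r) ` R)"
  by (rule bdd_belowI[of _ 0]) (auto intro: nonneg)

lemma D\<^sub>b_le: "\<lbrakk>h \<in> X; R \<subseteq> X; r \<in> R\<rbrakk> \<Longrightarrow> D\<^sub>b S h R \<le> S h h r"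
  unfolding D\<^sub>b_def by (rule cINF_lower[OF bdd_below_dist])

lemma D\<^sub>b_nonneg: "\<lbrakk>h \<in> X; R \<subseteq> X; R \<noteq> {}\<rbrakk> \<Longrightarrow> 0 \<le> D\<^sub>b S h R"
  unfolding D\<^sub>b_def by (rule cINF_greatest) (auto intro: nonneg)

lemma D\<^sub>b_less_obtain:
  assumes "h \<in> X" "R \<subseteq> X" "R \<noteq> {}" "D\<^sub>b S h R < c"
  obtains r where "r \<in> R" "S h h r < c"
  using assms cINF_less_iff[OF _ bdd_below_dist, of R h c] unfolding D\<^sub>b_def by blast

text \<open>A supremum of reals dominates its members only for a family that is bounded above. Such
  a bound comes from comparing every \<open>p'\<close> in \<open>P\<close> with one fixed
  \<open>r\<close> in \<open>R\<close> through \<open>p\<close>: the first leg is controlled by the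
  boundedness of \<open>P\<close>, the second is constant.\<close>

lemma D\<^sub>b_le_H\<^sub>b:
  assumes "P \<in> CB X S" "R \<in> CB X S" "p \<in> P"
  shows "D\<^sub>b S p R \<le> H\<^sub>b S P P R"
proof -
  obtain B where B: "S p' p' p \<le> B" if "p' \<in> P" for p'
    using assms unfolding CB_def Sb_bounded_def bdd_above_def by blast
  obtain r where r: "r \<in> R"
    using CB_D(2)[OF assms(2)] by blast
  have mem: "r \<in> X" "p \<in> X"
    using r assms CB_D by blast+
  have "D\<^sub>b S p' R \<le> s * (2 * B + S r r p)" if "p' \<in> P" for p'
  proof -
    have p': "p' \<in> X"
      using that CB_D(1)[OF assms(1)] by blast
    have "D\<^sub>b S p' R \<le> S p' p' r"
      by (rule D\<^sub>b_le[OF p' CB_D(1)[OF assms(2)] r])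
    also have "\<dots> \<le> s * (2 * S p' p' p + S r r p)"
      using p' mem by (intro triangle2)
    also have "\<dots> \<le> s * (2 * B + S r r p)"
      using B[OF that] s_ge_1 by (intro mult_left_mono) auto
    finally show ?thesis .
  qed
  then have "bdd_above ((\<lambda>p. D\<^sub>b S p R) ` P)"
    by (rule bdd_aboveI2)
  then have "D\<^sub>b S p R \<le> (SUP p\<in>P. D\<^sub>b S p R)"
    using assms(3) by (intro cSUP_upper)
  then show ?thesis
    unfolding H\<^sub>b_def by linarith
qed

end

section \<open>Symmetric spaces: distance to closed sets and geometric sequences\<close>

context symmetric_Sb_metric_space
begin

text \<open>Symmetry turns the term \<open>S r r y\<close> of the triangle inequality into
  \<open>S y y r\<close>. Isolating that term leaves a lower bound that does not depend on
  \<open>r\<close>, hence a lower bound for the infimum.\<close>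

lemma D\<^sub>b_triangle:
  assumes "x \<in> X" "y \<in> X" "R \<subseteq> X" "R \<noteq> {}"
  shows "D\<^sub>b S x R \<le> s * (2 * S x x y + D\<^sub>b S y R)"
proof -
  have "D\<^sub>b S x R / s - 2 * S x x y \<le> S y y r" if "r \<in> R" for r
  proof -
    have r: "r \<in> X"
      using that assms by blast
    have "D\<^sub>b S x R \<le> S x x r"
      using D\<^sub>b_le assms that by blast
    also have "\<dots> \<le> s * (2 * S x x y + S y y r)"
      using triangle2[OF assms(1) r assms(2)] symmetric[OF r assms(2)] by simp
    finally show ?thesis
      using s_ge_1 by (simp add: field_simps)
  qed
  then have "D\<^sub>b S x R / s - 2 * S x x y \<le> D\<^sub>b S y R"
    unfolding D\<^sub>b_def[of S y] using assms(4) by (intro cINF_greatest)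
  then show ?thesis
    using s_ge_1 by (simp add: field_simps)
qed

text \<open>A vanishing infimum yields points \<open>k n\<close> of \<open>K\<close> approaching
  \<open>x\<close>. Convergence has the limit in the third slot, so symmetry is applied before
  closedness.\<close>

lemma D\<^sub>b_eq_0_imp_mem:
  assumes "K \<in> CB X S" "x \<in> X" "D\<^sub>b S x K = 0"
  shows "x \<in> K"
proof -
  have "\<exists>k\<in>K. S x x k < inverse (real (Suc n))" for n
    using D\<^sub>b_less_obtain[OF assms(2) CB_D[OF assms(1)], of "inverse (real (Suc n))"] assms(3)
    by auto
  then obtain k where k: "\<And>n. k n \<in> K" "\<And>n. S x x (k n) < inverse (real (Suc n))"
    by metis
  have kX: "k n \<in> X" for n
    using k(1) CB_D(1)[OF assms(1)] by blast
  have "(\<lambda>n. S x x (k n)) \<longlonglongrightarrow> 0"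
    using nonneg[OF assms(2) assms(2) kX] less_imp_le[OF k(2)]
    by (intro tendsto_sandwich[OF _ _ tendsto_const LIMSEQ_inverse_real_of_nat]
        always_eventually allI)
  then have "Sb_converges S k x"
    unfolding Sb_converges_def using symmetric[OF kX assms(2)] by simp
  then show ?thesis
    using assms k(1) unfolding CB_def Sb_closed_def by blast
qed

text \<open>Each use of the triangle inequality costs a factor \<open>s\<close>, so splitting off
  one step after another produces a geometric series of ratio \<open>s * q\<close>; hence the
  condition \<open>s * q < 1\<close>. Symmetry covers pairs of indices in reverse order.\<close>

lemma Cauchy_if_geometric:
  assumes u: "\<And>n. u n \<in> X"
    and q: "0 \<le> q" "s * q < 1"
    and step: "\<And>n. S (u n) (u n) (u (Suc n)) \<le> C * q ^ n"
  shows "Sb_Cauchy S u"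
proof -
  \<comment> \<open>The constant solves \<open>2 * s * C + s * q * B = B\<close>.\<close>
  define B where "B = 2 * s * C / (1 - s * q)"
  have B_eq: "2 * s * C + s * q * B = B"
    using q by (simp add: B_def field_simps)
  have "0 \<le> C"
    using step[of 0] nonneg[OF u u u, of 0 0 1] by simp
  then have B_nonneg: "0 \<le> B"
    using s_ge_1 q by (simp add: B_def)
  have "S (u n) (u n) (u (n + k)) \<le> B * q ^ n" for n k
  proof (induction k arbitrary: n)
    case 0
    then show ?case
      using B_nonneg q u by (simp add: self_eq_0)
  next
    case (Suc k)
    have "S (u n) (u n) (u (n + Suc k))
        \<le> s * (2 * S (u n) (u n) (u (Suc n)) + S (u (Suc n)) (u (Suc n)) (u (Suc n + k)))"
      using triangle2[OF u u u, of n "n + Suc k" "Suc n"] symmetric[OF u u, of "Suc n" "Suc n + k"]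
      by simp
    also have "\<dots> \<le> s * (2 * (C * q ^ n) + B * q ^ Suc n)"
      using s_ge_1 step[of n] Suc.IH[of "Suc n"] by (intro mult_left_mono) auto
    also have "\<dots> = (2 * s * C + s * q * B) * q ^ n"
      by (simp add: algebra_simps)
    finally show ?case
      by (simp only: B_eq)
  qed
  then have le: "S (u n) (u n) (u m) \<le> B * q ^ n" if "n \<le> m" for n m
    using that by (metis le_add_diff_inverse)
  have "\<bar>q\<bar> < 1"
  proof -
    have "1 * q \<le> s * q"
      using s_ge_1 q by (intro mult_right_mono)
    then show ?thesis
      using q by linarith
  qed
  then have lim: "(\<lambda>n. B * q ^ n) \<longlonglongrightarrow> 0"
    using tendsto_mult_right_zero[OF LIMSEQ_power_zero[of q]] by simp
  show ?thesis
    unfolding Sb_Cauchy_def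
  proof (intro allI impI)
    fix e :: real
    assume "e > 0"
    then obtain N where N: "\<And>n. n \<ge> N \<Longrightarrow> B * q ^ n < e"
      using order_tendstoD(2)[OF lim] unfolding eventually_sequentially by blast
    have "\<bar>S (u n) (u n) (u m)\<bar> < e" if "n \<ge> N" "m \<ge> N" for n m
    proof (cases "n \<le> m")
      case True
      then show ?thesis
        using le[of n m] N[OF that(1)] nonneg[OF u u u, of n n m] by simp
    next
      case False
      then show ?thesis
        using le[of m n] N[OF that(2)] nonneg[OF u u u, of n n m] symmetric[OF u u, of m n] by simp
    qed
    then show "\<exists>N. \<forall>n\<ge>N. \<forall>m\<ge>N. \<bar>S (u n) (u n) (u m)\<bar> < e"
      by blast
  qed
qed

section \<open>The Suzuki-type condition and the fixed point\<close>

lemma Suzuki_step: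
  assumes mem: "x \<in> X" "y \<in> X" "z \<in> X" "T x \<in> CB X S" "y \<in> T x" and r: "0 \<le> r"
    and D: "D\<^sub>b S y (T y) \<le> r * S x x y"
  shows "\<eta> s r * D\<^sub>b S x (T x) \<le> S x x z \<or> \<eta> s r * D\<^sub>b S y (T y) \<le> S y y z"
proof (rule ccontr)
  assume neg: "\<not> ?thesis"
  \<comment> \<open>This identity makes the two strict bounds below add up to exactly
    \<open>S x x y\<close>: weight 2 from \<open>x\<close>, weight \<open>r\<close> from
    \<open>y\<close>.\<close>
  have eta: "s * \<eta> s r * (2 + r) = 1" "0 < \<eta> s r"
    using s_ge_1 r by (simp_all add: \<eta>_def)
  have Dx: "D\<^sub>b S x (T x) \<le> S x x y"
    using mem CB_D by (intro D\<^sub>b_le)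
  have "S x x z < \<eta> s r * S x x y" "S y y z < \<eta> s r * (r * S x x y)"
    using neg mult_left_mono[OF Dx, of "\<eta> s r"] mult_left_mono[OF D, of "\<eta> s r"] eta by linarith+
  then have "s * (2 * S x x z + S y y z) < s * (2 * (\<eta> s r * S x x y) + \<eta> s r * (r * S x x y))"
    using s_ge_1 by (intro mult_strict_left_mono) auto
  also have "\<dots> = (s * \<eta> s r * (2 + r)) * S x x y"
    by (simp add: algebra_simps)
  also have "\<dots> = S x x y"
    by (simp add: eta)
  finally show False
    using triangle2[OF mem(1-3)] by linarith
qed

theorem Suzuki_fixed_point:
  assumes complete: "Sb_complete X S"
    and T: "\<And>h. h \<in> X \<Longrightarrow> T h \<in> CB X S"
    and r: "0 \<le> r" "r < 1 / s"
    and contr: "\<And>h t. \<lbrakk>h \<in> X; t \<in> X; \<eta> s r * D\<^sub>b S h (T h) \<le> S h h t\<rbrakk>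
      \<Longrightarrow> H\<^sub>b S (T h) (T h) (T t) \<le> r * S h h t"
  shows "\<exists>z\<in>X. z \<in> T z"
\<comment> \<open>Without fixed points, any \<open>y\<close> in \<open>T x\<close> differs from
  \<open>x\<close>, so \<open>S x x y > 0\<close>; this gives the strict inequality by which the
  next orbit point is chosen.\<close>
proof (rule ccontr)
  assume no_fix: "\<not> ?thesis"
  have TX: "T x \<subseteq> X" "T x \<noteq> {}" if "x \<in> X" for x
    using CB_D[OF T[OF that]] by auto
  have D_contr: "D\<^sub>b S y (T t) \<le> r * S x x t"
    if "x \<in> X" "t \<in> X" "y \<in> T x" "\<eta> s r * D\<^sub>b S x (T x) \<le> S x x t" for x y t
    using D\<^sub>b_le_H\<^sub>b[OF T T] contr that by (meson order_trans)
  \<comment> \<open>With \<open>t = y\<close> the premise of the contraction is automatic, since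
    \<open>\<eta> s r \<le> 1\<close>.\<close>
  have D_step: "D\<^sub>b S y (T y) \<le> r * S x x y" if "x \<in> X" "y \<in> T x" for x y
  proof (rule D_contr[OF that(1) _ that(2)])
    show y: "y \<in> X"
      using that TX by blast
    have "1 * 1 \<le> s * (2 + r)"
      using s_ge_1 r by (intro mult_mono) auto
    then have "\<eta> s r \<le> 1"
      by (simp add: \<eta>_def)
    then have "\<eta> s r * D\<^sub>b S x (T x) \<le> D\<^sub>b S x (T x)"
      using D\<^sub>b_nonneg that(1) TX by (intro mult_left_le_one_le) (use r s_ge_1 in \<open>auto simp: \<eta>_def\<close>)
    also have "\<dots> \<le> S x x y"
      using D\<^sub>b_le that TX by blast
    finally show "\<eta> s r * D\<^sub>b S x (T x) \<le> S x x y" .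
  qed
  \<comment> \<open>The infimum in \<open>D\<^sub>b\<close> may not be attained, so \<open>r\<close>
    is relaxed to a larger ratio that still satisfies \<open>s * q < 1\<close>.\<close>
  obtain q where q: "r < q" "q < 1 / s"
    using dense[OF r(2)] by blast
  have q': "0 \<le> q" "s * q < 1"
    using q r s_ge_1 by (auto simp: field_simps)
  have next_point: "\<exists>w\<in>T y. S y y w \<le> q * S x x y" if "x \<in> X" "y \<in> T x" for x y
  proof -
    have y: "y \<in> X"
      using that TX by blast
    have "S x x y > 0"
      using pos[OF that(1) y] that no_fix by blast
    then have "D\<^sub>b S y (T y) < q * S x x y"
      using D_step[OF that] q(1) mult_strict_right_mono[OF q(1), of "S x x y"] by linarith
    then obtain w where "w \<in> T y" "S y y w < q * S x x y"
      by (rule D\<^sub>b_less_obtain[OF y TX[OF y]])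
    then show ?thesis
      by (intro bexI[of _ w]) auto
  qed
  obtain x0 y0 where x0: "x0 \<in> X" "y0 \<in> T x0"
    using nonempty TX by blast
  \<comment> \<open>The next point depends on the last two, so the recursion runs over pairs of
    consecutive orbit points.\<close>
  have "\<exists>f. \<forall>n. (fst (f n) \<in> X \<and> snd (f n) \<in> T (fst (f n))) \<and>
      (fst (f (Suc n)) = snd (f n) \<and>
       S (fst (f (Suc n))) (fst (f (Suc n))) (snd (f (Suc n))) \<le> q * S (fst (f n)) (fst (f n)) (snd (f n)))"
  proof (rule dependent_nat_choice)
    show "\<exists>p. fst p \<in> X \<and> snd p \<in> T (fst p)"
      using x0 by auto
  next
    fix p :: "'a \<times> 'a" and n :: nat
    assume p: "fst p \<in> X \<and> snd p \<in> T (fst p)"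
    then obtain w where "w \<in> T (snd p)" "S (snd p) (snd p) w \<le> q * S (fst p) (fst p) (snd p)"
      using next_point by blast
    then show "\<exists>p'. (fst p' \<in> X \<and> snd p' \<in> T (fst p')) \<and> fst p' = snd p \<and>
        S (fst p') (fst p') (snd p') \<le> q * S (fst p) (fst p) (snd p)"
      using p TX by (intro exI[of _ "(snd p, w)"]) auto
  qed
  then obtain f where f: "\<And>n. fst (f n) \<in> X" "\<And>n. snd (f n) \<in> T (fst (f n))"
      "\<And>n. fst (f (Suc n)) = snd (f n)"
      "\<And>n. S (fst (f (Suc n))) (fst (f (Suc n))) (snd (f (Suc n)))
        \<le> q * S (fst (f n)) (fst (f n)) (snd (f n))"
    by blast
  define u where "u = (\<lambda>n. fst (f n))"
  have u: "u n \<in> X" "u (Suc n) \<in> T (u n)" for n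
    using f(1-3) by (simp_all add: u_def)
  have u_step: "S (u (Suc n)) (u (Suc n)) (u (Suc (Suc n))) \<le> q * S (u n) (u n) (u (Suc n))" for n
    using f(4)[of n] by (simp add: u_def f(3))
  have "S (u n) (u n) (u (Suc n)) \<le> S (u 0) (u 0) (u 1) * q ^ n" for n
  proof (induction n)
    case (Suc n)
    then show ?case
      using u_step[of n] mult_left_mono[OF Suc q'(1)] by (simp add: algebra_simps)
  qed simp
  then have "Sb_Cauchy S u"
    using Cauchy_if_geometric u(1) q' by blast
  then obtain z where z: "z \<in> X" and "Sb_converges S u z"
    using complete u(1) unfolding Sb_complete_def by blast
  then have lim: "(\<lambda>n. S (u n) (u n) z) \<longlonglongrightarrow> 0"
    by (simp add: Sb_converges_def)
  have "\<exists>m\<in>{n, Suc n}. \<eta> s r * D\<^sub>b S (u m) (T (u m)) \<le> S (u m) (u m) z" for n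
    using Suzuki_step[OF u(1) u(1) z T[OF u(1)] u(2) r(1) D_step[OF u]] by blast
  then obtain m where m: "\<And>n. m n \<in> {n, Suc n}"
      "\<And>n. \<eta> s r * D\<^sub>b S (u (m n)) (T (u (m n))) \<le> S (u (m n)) (u (m n)) z"
    by metis
  \<comment> \<open>\<open>m\<close> may repeat values, but \<open>n \<le> m n\<close> suffices for
    passing to limits along it.\<close>
  have m_lim: "filterlim m at_top sequentially"
    using m(1) by (intro filterlim_at_top_mono[OF filterlim_ident] always_eventually allI)
      (metis insertE le_SucI order_refl singletonD)
  \<comment> \<open>The detour goes through \<open>u (Suc (m n))\<close>, a point of
    \<open>T (u (m n))\<close>, so the contraction for \<open>u (m n)\<close> and \<open>z\<close>
    bounds its distance to \<open>T z\<close>.\<close>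
  have Dz: "D\<^sub>b S z (T z)
      \<le> s * (2 * S (u (Suc (m n))) (u (Suc (m n))) z + r * S (u (m n)) (u (m n)) z)" for n
  proof -
    have "D\<^sub>b S z (T z) \<le> s * (2 * S z z (u (Suc (m n))) + D\<^sub>b S (u (Suc (m n))) (T z))"
      by (rule D\<^sub>b_triangle[OF z u(1) TX[OF z]])
    also have "\<dots> \<le> s * (2 * S (u (Suc (m n))) (u (Suc (m n))) z + r * S (u (m n)) (u (m n)) z)"
      using s_ge_1 D_contr[OF u(1) z u(2) m(2)] symmetric[OF z u(1)]
      by (intro mult_left_mono add_mono) auto
    finally show ?thesis .
  qed
  have "(\<lambda>n. s * (2 * S (u (Suc (m n))) (u (Suc (m n))) z + r * S (u (m n)) (u (m n)) z))
      \<longlonglongrightarrow> s * (2 * 0 + r * 0)"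
    using filterlim_compose[OF lim m_lim] filterlim_compose[OF LIMSEQ_Suc[OF lim] m_lim]
    by (intro tendsto_intros)
  then have "D\<^sub>b S z (T z) \<le> s * (2 * 0 + r * 0)"
    by (rule LIMSEQ_le_const) (use Dz in blast)
  then have "D\<^sub>b S z (T z) = 0"
    using D\<^sub>b_nonneg[OF z TX[OF z]] by simp
  then show False
    using D\<^sub>b_eq_0_imp_mem[OF T[OF z] z] no_fix z by blast
qed

end

theorem theorem3p3:
  fixes X :: "'a set" and S :: "'a \<Rightarrow> 'a \<Rightarrow> 'a \<Rightarrow> real" and s :: real
    and T :: "'a \<Rightarrow> 'a set"
  assumes "symmetric_Sb_metric_space X S s"
    and "Sb_complete X S"
    and "\<forall>h\<in>X. T h \<in> CB X S"
    and "\<exists>r\<in>{0..<1/s}. \<forall>h\<in>X. \<forall>t\<in>X.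
      \<eta> s r * D\<^sub>b S h (T h) \<le> S h h t \<longrightarrow> H\<^sub>b S (T h) (T h) (T t) \<le> r * S h h t"
  shows "\<exists>z\<in>X. z \<in> T z"
proof -
  obtain r where r: "0 \<le> r" "r < 1 / s"
    and contr: "\<And>h t. \<lbrakk>h \<in> X; t \<in> X; \<eta> s r * D\<^sub>b S h (T h) \<le> S h h t\<rbrakk>
      \<Longrightarrow> H\<^sub>b S (T h) (T h) (T t) \<le> r * S h h t"
    using assms(4) by auto
  show ?thesis
    using symmetric_Sb_metric_space.Suzuki_fixed_point[OF assms(1,2) _ r contr] assms(3) by blast
qed

end
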